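(* Let $n\ge 2$, let $P=(p_1,\dots,p_n)$ and $Q=(q_1,\dots,q_n)$ be elements of $\Gamma_n$, and let $r,R$ be real numbers with $0<r\le \frac{p_i}{q_i}\le R<\infty$ for all $i\in\{1,\dots,n\}$. Then $$\frac{1}{2(R+1)^2}\,J(P\|Q)\le G(P\|Q)\le \frac{1}{2(r+1)^2}\,J(P\|Q).$$
   Context: $\Gamma_n=\{P=(p_1,\dots,p_n): p_i>0,\ \sum_{i=1}^n p_i=1\}$ is the set of finite discrete probability distributions with strictly positive entries. $\ln$ is the natural logarithm. The relative arithmetic-geometric divergence is $G(P\|Q)=\sum_{i=1}^n \left(\frac{p_i+q_i}{2}\right)\ln\left(\frac{p_i+q_i}{2p_i}\right)$. The J-divergence is $J(P\|Q)=\sum_{i=1}^n (p_i-q_i)\ln\left(\frac{p_i}{q_i}\right)$. *)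

theory Defs
  imports Complex_Main
begin

text \<open>An \<open>n\<close>-tuple of reals is a function on \<open>nat\<close> of which only the values at the indices
  \<open>1, \<dots>, n\<close> matter; values at other indices are unconstrained and are never used.\<close>

definition Gamma_simplex :: "nat \<Rightarrow> (nat \<Rightarrow> real) set" where
  "Gamma_simplex n = {p. (\<forall>i\<in>{1..n}. p i > 0) \<and> (\<Sum>i=1..n. p i) = 1}"

text \<open>Relative arithmetic-geometric divergence \<open>G(P\<parallel>Q)\<close>, which is not symmetric in
  \<open>P\<close> and \<open>Q\<close>.\<close>

definition AG_div :: "nat \<Rightarrow> (nat \<Rightarrow> real) \<Rightarrow> (nat \<Rightarrow> real) \<Rightarrow> real" where
  "AG_div n p q = (\<Sum>i=1..n. ((p i + q i) / 2) * ln ((p i + q i) / (2 * p i)))"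

definition J_div :: "nat \<Rightarrow> (nat \<Rightarrow> real) \<Rightarrow> (nat \<Rightarrow> real) \<Rightarrow> real" where
  "J_div n p q = (\<Sum>i=1..n. (p i - q i) * ln (p i / q i))"

end

theory Submission
  imports Defs "HOL-Analysis.Convex"
begin

text \<open>With \<open>x\<^sub>i = p\<^sub>i / q\<^sub>i\<close>, both divergences are Csiszar divergences \<open>\<Sum> q\<^sub>i f(x\<^sub>i)\<close>, with generators
  \<open>f\<^sub>G x = (x + 1)/2 \<cdot> ln ((x + 1)/(2 x))\<close> and \<open>f\<^sub>J x = (x - 1) ln x\<close>. Since
  \<open>f\<^sub>G'' x = f\<^sub>J'' x / (2 (x + 1)\<^sup>2)\<close>, the functions \<open>f\<^sub>G - f\<^sub>J / (2 (R + 1)\<^sup>2)\<close> and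
  \<open>f\<^sub>J / (2 (r + 1)\<^sup>2) - f\<^sub>G\<close> are convex on \<open>[r, R]\<close>. As they vanish at 1, which lies in \<open>[r, R]\<close>,
  their divergences are nonnegative.\<close>

text \<open>Convexity puts \<open>f\<close> above its tangent at 1, so
  \<open>f x \<ge> f' 1 * (x - 1)\<close> on \<open>C\<close>. At \<open>x = p i / q i\<close>,
  after multiplication by \<open>q i\<close>, the tangent term becomes
  \<open>f' 1 * (p i - q i)\<close>, and these terms sum to 0 because \<open>p\<close> and
  \<open>q\<close> have equal totals.\<close>

lemma csiszar_divergence_nonneg:
  fixes f f' f'' :: "real \<Rightarrow> real" and p q :: "'a \<Rightarrow> real"
  assumes "convex C" and "1 \<in> C" and "f 1 = 0"
    and f': "\<And>x. x \<in> C \<Longrightarrow> (f has_real_derivative f' x) (at x)"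
    and f'': "\<And>x. x \<in> C \<Longrightarrow> (f' has_real_derivative f'' x) (at x)"
    and nonneg: "\<And>x. x \<in> C \<Longrightarrow> 0 \<le> f'' x"
    and q: "\<And>i. i \<in> A \<Longrightarrow> 0 < q i"
    and ratio: "\<And>i. i \<in> A \<Longrightarrow> p i / q i \<in> C"
    and "sum p A = sum q A"
  shows "0 \<le> (\<Sum>i\<in>A. q i * f (p i / q i))"
proof -
  have "0 = (\<Sum>i\<in>A. f' 1 * (p i - q i))"
    using assms(9) by (simp add: sum_subtractf flip: sum_distrib_left)
  also have "\<dots> \<le> (\<Sum>i\<in>A. q i * f (p i / q i))"
  proof (rule sum_mono)
    fix i assume i: "i \<in> A"
    have "f' 1 * (p i / q i - 1) \<le> f (p i / q i)"
      using f''_imp_f'[OF assms(1) f' f'' nonneg assms(2) ratio[OF i]] assms(3) by simp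
    then have "q i * (f' 1 * (p i / q i - 1)) \<le> q i * f (p i / q i)"
      using q[OF i] by (intro mult_left_mono) auto
    moreover have "q i * (f' 1 * (p i / q i - 1)) = f' 1 * (p i - q i)"
      using q[OF i] by (simp add: field_simps)
    ultimately show "f' 1 * (p i - q i) \<le> q i * f (p i / q i)" by simp
  qed
  finally show ?thesis .
qed

definition AG_gen :: "real \<Rightarrow> real" where
  "AG_gen x = (x + 1) / 2 * ln ((x + 1) / (2 * x))"

definition J_gen :: "real \<Rightarrow> real" where
  "J_gen x = (x - 1) * ln x"

lemma AG_gen_deriv:
  assumes "0 < x"
  shows "(AG_gen has_real_derivative ln ((x + 1) / (2 * x)) / 2 - 1 / (2 * x)) (at x)"
  unfolding AG_gen_def[abs_def] using assms
  by (auto intro!: derivative_eq_intros)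

text \<open>The logarithmic term contributes \<open>- 1 / (2 * x * (x + 1))\<close> and the
  reciprocal term \<open>1 / (2 * x^2)\<close>; over a common denominator the numerator collapses to
  1.\<close>

lemma AG_gen_deriv2:
  assumes "0 < x"
  shows "((\<lambda>x. ln ((x + 1) / (2 * x)) / 2 - 1 / (2 * x)) has_real_derivative
    1 / (2 * x^2 * (x + 1))) (at x)"
  using assms
  by (auto intro!: derivative_eq_intros)
     (simp add: divide_simps, simp add: algebra_simps power2_eq_square)

lemma J_gen_deriv:
  assumes "0 < x"
  shows "(J_gen has_real_derivative ln x + 1 - 1 / x) (at x)"
  unfolding J_gen_def[abs_def] using assms
  by (auto intro!: derivative_eq_intros simp: field_simps)

lemma J_gen_deriv2:
  assumes "0 < x"
  shows "((\<lambda>x. ln x + 1 - 1 / x) has_real_derivative (x + 1) / x^2) (at x)"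
  using assms by (auto intro!: derivative_eq_intros simp: field_simps power2_eq_square)

lemma AG_div_eq:
  assumes "\<And>i. i \<in> {1..n} \<Longrightarrow> 0 < q i"
  shows "AG_div n p q = (\<Sum>i=1..n. q i * AG_gen (p i / q i))"
  unfolding AG_div_def
proof (rule sum.cong[OF refl])
  fix i assume "i \<in> {1..n}"
  then have q: "0 < q i" by (rule assms)
  have "(p i / q i + 1) / (2 * (p i / q i)) = (p i + q i) / (2 * p i)"
    \<comment> \<open>If \<open>p i = 0\<close>, both denominators vanish and both sides are 0 by
      the convention for division by zero.\<close>
    using q by (cases "p i = 0") (auto simp: field_simps)
  then show "(p i + q i) / 2 * ln ((p i + q i) / (2 * p i)) = q i * AG_gen (p i / q i)"
    using q by (simp add: AG_gen_def field_simps)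
qed

lemma J_div_eq:
  assumes "\<And>i. i \<in> {1..n} \<Longrightarrow> 0 < q i"
  shows "J_div n p q = (\<Sum>i=1..n. q i * J_gen (p i / q i))"
  unfolding J_div_def
proof (rule sum.cong[OF refl])
  fix i assume "i \<in> {1..n}"
  then have "q i * (p i / q i - 1) = p i - q i"
    using assms[of i] by (simp add: field_simps)
  then show "(p i - q i) * ln (p i / q i) = q i * J_gen (p i / q i)"
    by (simp add: J_gen_def flip: mult.assoc)
qed

text \<open>Summing \<open>r * q i \<le> p i \<le> R * q i\<close> and dividing by the common
  positive total gives both bounds. This puts the base point 1 of the tangent argument inside the
  interval.\<close>

lemma one_between_ratio_bounds:
  fixes p q :: "'a \<Rightarrow> real"
  assumes "finite A" "A \<noteq> {}" "sum p A = sum q A"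
    and q: "\<And>i. i \<in> A \<Longrightarrow> 0 < q i"
    and bounds: "\<And>i. i \<in> A \<Longrightarrow> r \<le> p i / q i \<and> p i / q i \<le> R"
  shows "r \<le> 1 \<and> 1 \<le> R"
proof -
  have pos: "0 < sum q A" using assms by (intro sum_pos) auto
  have "r * sum q A \<le> sum p A" "sum p A \<le> R * sum q A"
    using q bounds by (auto simp: sum_distrib_left field_simps intro!: sum_mono)
  with pos assms(3) show ?thesis by simp
qed

theorem proposition6p2:
  fixes n :: nat and p q :: "nat \<Rightarrow> real" and r R :: real
  assumes "n \<ge> 2"
    and "p \<in> Gamma_simplex n"
    and "q \<in> Gamma_simplex n"
    and "0 < r"
    and "\<forall>i\<in>{1..n}. r \<le> p i / q i \<and> p i / q i \<le> R"
  shows "1 / (2 * (R + 1)^2) * J_div n p q \<le> AG_div n p q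
       \<and> AG_div n p q \<le> 1 / (2 * (r + 1)^2) * J_div n p q"
proof -
  have q: "0 < q i" if "i \<in> {1..n}" for i
    using assms(3) that by (simp add: Gamma_simplex_def)
  have sums: "sum p {1..n} = sum q {1..n}"
    using assms(2,3) by (simp add: Gamma_simplex_def)
  have one: "1 \<in> {r..R}"
    using one_between_ratio_bounds[of "{1..n}" p q r R] assms(1,5) sums q by auto
  have ratio: "p i / q i \<in> {r..R}" if "i \<in> {1..n}" for i
    using assms(5) that by simp
  have pos: "0 < x" if "x \<in> {r..R}" for x
    using assms(4) that by simp
  have vanish: "AG_gen 1 = 0" "J_gen 1 = 0"
    by (simp_all add: AG_gen_def J_gen_def)
  \<comment> \<open>The coefficients stay arbitrary so that both inequalities become instances of
    one criterion.\<close>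
  have comb: "(\<Sum>i=1..n. q i * (a * AG_gen (p i / q i) + b * J_gen (p i / q i)))
      = a * AG_div n p q + b * J_div n p q" for a b
  proof -
    have "AG_div n p q = (\<Sum>i=1..n. q i * AG_gen (p i / q i))"
      by (rule AG_div_eq) (rule q)
    moreover have "J_div n p q = (\<Sum>i=1..n. q i * J_gen (p i / q i))"
      by (rule J_div_eq) (rule q)
    ultimately show ?thesis
      by (simp add: sum_distrib_left sum.distrib algebra_simps)
  qed
  \<comment> \<open>The second derivative of \<open>a * AG_gen x + b * J_gen x\<close> is
    \<open>a / (2 * (x + 1)^2) + b\<close> times the positive factor \<open>(x + 1) / x^2\<close>,
    so convexity reduces to the sign of the first factor.\<close>
  have criterion: "0 \<le> a * AG_div n p q + b * J_div n p q"
    if coeff: "\<And>x. x \<in> {r..R} \<Longrightarrow> 0 \<le> a / (2 * (x + 1)^2) + b" for a b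
  proof -
    have nonneg: "0 \<le> a * (1 / (2 * x^2 * (x + 1))) + b * ((x + 1) / x^2)" if x: "x \<in> {r..R}" for x
    proof -
      have "a * (1 / (2 * x^2 * (x + 1))) + b * ((x + 1) / x^2)
          = (a / (2 * (x + 1)^2) + b) * ((x + 1) / x^2)"
        using pos[OF x] by (simp add: divide_simps) (simp add: algebra_simps power2_eq_square)
      then show ?thesis using coeff[OF x] pos[OF x] by simp
    qed
    have deriv: "((\<lambda>x. a * AG_gen x + b * J_gen x) has_real_derivative
        a * (ln ((x + 1) / (2 * x)) / 2 - 1 / (2 * x)) + b * (ln x + 1 - 1 / x)) (at x)"
      if "x \<in> {r..R}" for x
      using pos[OF that] by (intro DERIV_add DERIV_cmult AG_gen_deriv J_gen_deriv)
    have deriv2: "((\<lambda>x. a * (ln ((x + 1) / (2 * x)) / 2 - 1 / (2 * x)) + b * (ln x + 1 - 1 / x))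
        has_real_derivative a * (1 / (2 * x^2 * (x + 1))) + b * ((x + 1) / x^2)) (at x)"
      if "x \<in> {r..R}" for x
      using pos[OF that] by (intro DERIV_add DERIV_cmult AG_gen_deriv2 J_gen_deriv2)
    have "a * AG_gen 1 + b * J_gen 1 = 0"
      by (simp add: vanish)
    from csiszar_divergence_nonneg[OF convex_real_interval(5) one this deriv deriv2 nonneg q ratio sums]
    have "0 \<le> (\<Sum>i=1..n. q i * (a * AG_gen (p i / q i) + b * J_gen (p i / q i)))"
      by simp
    then show ?thesis by (simp only: comb)
  qed
  \<comment> \<open>Lower bound: \<open>1 / (2 * (x + 1)^2)\<close> decreases in \<open>x\<close>,
    so on the interval it is smallest at \<open>R\<close>; this fixes the constant.\<close>
  have "0 \<le> 1 * AG_div n p q + (- (1 / (2 * (R + 1)^2))) * J_div n p q"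
  proof (rule criterion)
    fix x assume x: "x \<in> {r..R}"
    have "1 / (2 * (R + 1)^2) \<le> 1 / (2 * (x + 1)^2)"
      using x pos[OF x] by (intro divide_left_mono mult_left_mono power_mono mult_pos_pos) auto
    then show "0 \<le> 1 / (2 * (x + 1)^2) + - (1 / (2 * (R + 1)^2))" by simp
  qed
  \<comment> \<open>Upper bound: the same quantity is largest at \<open>r\<close>, and the signs of
    both coefficients are reversed.\<close>
  moreover have "0 \<le> - 1 * AG_div n p q + 1 / (2 * (r + 1)^2) * J_div n p q"
  proof (rule criterion)
    fix x assume x: "x \<in> {r..R}"
    have "1 / (2 * (x + 1)^2) \<le> 1 / (2 * (r + 1)^2)"
      using x assms(4) by (intro divide_left_mono mult_left_mono power_mono mult_pos_pos) auto
    then show "0 \<le> - 1 / (2 * (x + 1)^2) + 1 / (2 * (r + 1)^2)" by simp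
  qed
  ultimately show ?thesis by simp
qed

end
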